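(* If the Borel set $C=\{x\in\mathbb{R}:\mu(\{x\})+\pi_{X=x}(D)=0\}$ satisfies $\mu(C)=0$, in particular when $\mu$ is discrete, then condition $(\mathcal{D})$ holds if and only if property $(\mathcal{R}_+)$ holds.
   Context: Setting: $\mathcal{Y}$ is a separable Banach space with Borel $\sigma$-algebra $\mathcal{B}(\mathcal{Y})$, and $\pi$ is a probability measure on $\mathbb{R}\times\mathcal{Y}$ (with its Borel $\sigma$-algebra) with first marginal $\mu$ on $\mathbb{R}$ and second marginal $\nu$ on $\mathcal{Y}$. Fix probability kernels $(\pi_{X=x})_{x\in\mathbb{R}}$ (probability measures on $\mathcal{Y}$) and $(\pi_{Y=y})_{y\in\mathcal{Y}}$ (probability measures on $\mathbb{R}$) disintegrating $\pi$: $\pi(dx,dy)=\mu(dx)\,\pi_{X=x}(dy)=\nu(dy)\,\pi_{Y=y}(dx)$. $D$ is the Borel set $D=\{y\in\mathcal{Y}:\pi_{Y=y}\text{ is a Dirac mass}\}$. $L^1_+(\mu)$ denotes the set of non-negative elements of $L^1(\mu)$. A probability measure is discrete if it is carried by an at most countable set. Condition $(\mathcal{D})$: $\pi_{X=x}(D)>0$ for $\mu$-a.e. $x$. Property $(\mathcal{R}_+)$: for every $f\in L^1_+(\mu)$ there exists a measurable $g:\mathcal{Y}\to\mathbb{R}_+=[0,\infty)$ such that $f(x)=\int_{\mathcal{Y}}g(y)\,\pi_{X=x}(dy)$ for $\mu$-a.e. $x$. *)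

theory Defs
  imports "HOL-Probability.Probability"
begin

text \<open>
  The separable Banach space is a type of class \<open>banach\<close> and \<open>second_countable_topology\<close> (for metric
  spaces, second countability is separability).  All measures live on the Borel \<open>\<sigma>\<close>-algebra; on
  \<open>real \<times> 'y\<close> it coincides with the product \<open>\<sigma>\<close>-algebra by \<open>borel_prod\<close>.
\<close>

definition marg1 :: "(real \<times> 'y::topological_space) measure \<Rightarrow> real measure" where
  "marg1 P = distr P borel fst"

definition marg2 :: "(real \<times> 'y::topological_space) measure \<Rightarrow> 'y measure" where
  "marg2 P = distr P borel snd"

text \<open>
  Measurability into \<open>prob_algebra borel\<close> says that the map is a probability kernel.  The equations
  express \<open>P(dx,dy) = \<mu>(dx) K\<^sub>x(dy)\<close> and \<open>P(dx,dy) = \<nu>(dy) L\<^sub>y(dx)\<close> respectively.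
\<close>

definition disintegrates1 ::
  "(real \<times> 'y::topological_space) measure \<Rightarrow> (real \<Rightarrow> 'y measure) \<Rightarrow> bool" where
  "disintegrates1 P K \<longleftrightarrow>
     K \<in> borel \<rightarrow>\<^sub>M prob_algebra borel \<and>
     (\<forall>E \<in> sets borel. emeasure P E = (\<integral>\<^sup>+ x. emeasure (K x) {y. (x, y) \<in> E} \<partial>marg1 P))"

definition disintegrates2 ::
  "(real \<times> 'y::topological_space) measure \<Rightarrow> ('y \<Rightarrow> real measure) \<Rightarrow> bool" where
  "disintegrates2 P L \<longleftrightarrow>
     L \<in> borel \<rightarrow>\<^sub>M prob_algebra borel \<and>
     (\<forall>E \<in> sets borel. emeasure P E = (\<integral>\<^sup>+ y. emeasure (L y) {x. (x, y) \<in> E} \<partial>marg2 P))"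

definition is_dirac :: "real measure \<Rightarrow> bool" where
  "is_dirac M \<longleftrightarrow> (\<exists>a. M = return borel a)"

definition dirac_set :: "('y \<Rightarrow> real measure) \<Rightarrow> 'y set" where
  "dirac_set L = {y. is_dirac (L y)}"

definition C_set ::
  "real measure \<Rightarrow> (real \<Rightarrow> 'y measure) \<Rightarrow> ('y \<Rightarrow> real measure) \<Rightarrow> real set" where
  "C_set \<mu> K L = {x. emeasure \<mu> {x} + emeasure (K x) (dirac_set L) = 0}"

definition discrete_measure :: "real measure \<Rightarrow> bool" where
  "discrete_measure \<mu> \<longleftrightarrow> (\<exists>S. countable S \<and> emeasure \<mu> (- S) = 0)"

definition cond_D ::
  "real measure \<Rightarrow> (real \<Rightarrow> 'y measure) \<Rightarrow> ('y \<Rightarrow> real measure) \<Rightarrow> bool" where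
  "cond_D \<mu> K L \<longleftrightarrow> (AE x in \<mu>. emeasure (K x) (dirac_set L) > 0)"

text \<open>
  Elements of \<open>L\<^sup>1\<^sub>+(\<mu>)\<close> are represented by integrable functions that are nonnegative almost everywhere.
  The integral of \<open>g\<close> is the Lebesgue integral with values in \<open>[0,\<infinity>]\<close>: the Bochner integral would
  silently be \<open>0\<close> for a nonintegrable \<open>g\<close>.
\<close>

definition prop_R_plus ::
  "real measure \<Rightarrow> (real \<Rightarrow> 'y::topological_space measure) \<Rightarrow> bool" where
  "prop_R_plus \<mu> K \<longleftrightarrow>
     (\<forall>f :: real \<Rightarrow> real. integrable \<mu> f \<and> (AE x in \<mu>. f x \<ge> 0) \<longrightarrow>
        (\<exists>g :: 'y \<Rightarrow> real. g \<in> borel_measurable borel \<and> (\<forall>y. g y \<ge> 0) \<and>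
           (AE x in \<mu>. ennreal (f x) = (\<integral>\<^sup>+ y. ennreal (g y) \<partial>K x))))"

text \<open>
  The sets \<open>D\<close> and \<open>C\<close> are Borel, so the values of \<open>emeasure\<close> on them are not the default value \<open>0\<close>
  of a nonmeasurable set.
\<close>

lemma is_dirac_iff:
  assumes "prob_space M" and [measurable_cong, simp]: "sets M = sets borel"
  shows "is_dirac M \<longleftrightarrow> (\<forall>q \<in> \<rat>. emeasure M {..q} = 0 \<or> emeasure M {..q} = 1)"
proof
  assume "is_dirac M"
  then show "\<forall>q \<in> \<rat>. emeasure M {..q} = 0 \<or> emeasure M {..q} = 1"
    by (auto simp: is_dirac_def indicator_def)
next
  interpret prob_space M by fact
  assume *: "\<forall>q \<in> \<rat>. emeasure M {..q} = 0 \<or> emeasure M {..q} = 1"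
  have "AE z in M. z \<le> q \<longleftrightarrow> emeasure M {..q} = 1" if "q \<in> \<rat>" for q
  proof (cases "emeasure M {..q} = 1")
    case True
    then have "AE z in M. z \<in> {..q}"
      by (subst AE_in_set_eq_1) (auto simp: emeasure_eq_measure)
    then show ?thesis using True by auto
  next
    case False
    then have "{..q} \<in> null_sets M" using * that by auto
    then have "AE z in M. z \<notin> {..q}" by (rule AE_not_in)
    then show ?thesis using False by auto
  qed
  then have ae: "AE z in M. \<forall>q \<in> \<rat>. z \<le> q \<longleftrightarrow> emeasure M {..q} = 1"
    by (subst AE_ball_countable) (auto simp: countable_rat)
  have "\<exists>a. \<forall>q \<in> \<rat>. a \<le> q \<longleftrightarrow> emeasure M {..q} = 1"
  proof (rule ccontr)
    assume "\<not> ?thesis"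
    with ae have "AE z in M. False" by (rule_tac eventually_mono) blast+
    then show False by simp
  qed
  then obtain a where a: "\<forall>q \<in> \<rat>. a \<le> q \<longleftrightarrow> emeasure M {..q} = 1" ..
  from ae have ae': "AE z in M. z = a"
  proof eventually_elim
    case (elim z)
    then have eq: "\<forall>q \<in> \<rat>. z \<le> q \<longleftrightarrow> a \<le> q" using a by auto
    show "z = a"
    proof (rule ccontr)
      assume "z \<noteq> a"
      then consider "z < a" | "a < z" by linarith
      then show False
      proof cases
        case 1
        then obtain q where "q \<in> \<rat>" "z < q" "q < a" using Rats_dense_in_real by blast
        then show False using eq by force
      next
        case 2
        then obtain q where "q \<in> \<rat>" "a < q" "q < z" using Rats_dense_in_real by blast
        then show False using eq by force
      qed
    qed
  qed
  have "M = return borel a"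
  proof (rule measure_eqI)
    fix A assume A: "A \<in> sets M"
    have "emeasure M A = (\<integral>\<^sup>+ z. indicator A z \<partial>M)" using A by simp
    also have "\<dots> = (\<integral>\<^sup>+ z. indicator A a \<partial>M)"
      by (rule nn_integral_cong_AE) (use ae' in auto)
    also have "\<dots> = indicator A a" by (simp add: emeasure_space_1)
    finally show "emeasure M A = emeasure (return borel a) A" using A by simp
  qed simp
  then show "is_dirac M" by (auto simp: is_dirac_def)
qed

lemma dirac_set_borel:
  fixes L :: "'y::topological_space \<Rightarrow> real measure"
  assumes L: "L \<in> borel \<rightarrow>\<^sub>M prob_algebra borel"
  shows "dirac_set L \<in> sets borel"
proof -
  have [measurable]: "L \<in> borel \<rightarrow>\<^sub>M subprob_algebra borel"
    using L by (rule measurable_prob_algebraD)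
  have m: "(\<lambda>y. emeasure (L y) {..q}) \<in> borel_measurable borel" for q
    by (rule measurable_emeasure_kernel[of L borel borel]) auto
  have "L y \<in> space (prob_algebra borel)" for y
    using measurable_space[OF L, of y] by simp
  then have "prob_space (L y)" "sets (L y) = sets borel" for y
    by (auto simp: space_prob_algebra)
  then have "dirac_set L =
    {y \<in> space borel. \<forall>r::rat. emeasure (L y) {..of_rat r} = 0 \<or> emeasure (L y) {..of_rat r} = 1}"
    by (simp add: dirac_set_def is_dirac_iff Rats_def)
  also have "\<dots> \<in> sets borel"
    by (intro sets.sets_Collect_countable_All) (use m in measurable)
  finally show ?thesis .
qed

lemma C_set_borel:
  fixes L :: "'y::topological_space \<Rightarrow> real measure"
  assumes \<mu>: "prob_space \<mu>" "sets \<mu> = sets borel"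
    and K: "K \<in> borel \<rightarrow>\<^sub>M prob_algebra borel"
    and L: "L \<in> borel \<rightarrow>\<^sub>M prob_algebra borel"
  shows "C_set \<mu> K L \<in> sets borel"
proof -
  interpret prob_space \<mu> by fact
  note [measurable] = dirac_set_borel[OF L]
  have [measurable]: "K \<in> borel \<rightarrow>\<^sub>M subprob_algebra borel"
    using K by (rule measurable_prob_algebraD)
  have m: "(\<lambda>x. emeasure (K x) (dirac_set L)) \<in> borel_measurable borel"
    by (rule measurable_emeasure_kernel[of K borel borel]) auto
  have "countable {x. measure \<mu> {x} \<noteq> 0}"
    by (rule countable_support)
  then have c: "{x. emeasure \<mu> {x} \<noteq> 0} \<in> sets borel"
    by (rule_tac sets.countable) (simp_all add: emeasure_eq_measure)
  have "C_set \<mu> K L = {x \<in> space borel. emeasure (K x) (dirac_set L) = 0} - {x. emeasure \<mu> {x} \<noteq> 0}"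
    by (auto simp: C_set_def)
  also have "\<dots> \<in> sets borel"
    using c measurable_sets[OF m, of "{0}"] by (simp add: vimage_def Int_def conj_commute sets.Diff)
  finally show ?thesis .
qed

end

theory Submission
  imports Defs
begin

text \<open>
  Every \<open>y \<in> D\<close> carries an atom \<open>a y\<close> with \<open>L\<^sub>y = \<delta>\<^bsub>a y\<^esub>\<close>.  Disintegrating the null event
  \<open>y \<in> D \<and> x \<noteq> a y\<close> along \<open>K\<close> shows that \<open>a = x\<close> holds \<open>K\<^sub>x\<close>-almost everywhere on \<open>D\<close>, so that under
  \<open>(\<D>)\<close> the function \<open>g = 1\<^sub>D \<cdot> (f / K(D)) \<circ> a\<close> represents \<open>f\<close>.

  Conversely, let \<open>x\<^sub>0\<close> be an atom of \<open>\<mu>\<close> and let \<open>g\<close> represent the indicator of \<open>{x\<^sub>0}\<close>.  Then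
  \<open>{g > 0}\<close> is charged by \<open>K\<^bsub>x\<^sub>0\<^esub>\<close>, but by almost no other \<open>K\<^sub>x\<close>, so \<open>L\<^sub>y = \<delta>\<^bsub>x\<^sub>0\<^esub>\<close> for almost every
  \<open>y\<close> in \<open>{g > 0}\<close>; hence \<open>K\<^bsub>x\<^sub>0\<^esub>(D) > 0\<close>.  When \<open>\<mu>(C) = 0\<close>, this leaves only points \<open>x\<close> with
  \<open>K\<^sub>x(D) > 0\<close>.
\<close>

section \<open>Kernels, marginals and null events\<close>

lemma prob_kernelD:
  assumes "K \<in> borel \<rightarrow>\<^sub>M prob_algebra borel"
  shows "prob_space (K x)" "sets (K x) = sets borel"
  using measurable_space[OF assms, of x] by (auto simp: space_prob_algebra)

lemma prob_space_marg1:
  fixes P :: "(real \<times> 'y::second_countable_topology) measure"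
  assumes "prob_space P" "sets P = sets borel"
  shows "prob_space (marg1 P)"
proof -
  have "fst \<in> P \<rightarrow>\<^sub>M (borel :: real measure)"
    by (simp add: measurable_cong_sets[OF assms(2) refl] flip: borel_prod)
  then show ?thesis
    unfolding marg1_def by (rule prob_space.prob_space_distr[OF assms(1)])
qed

text \<open>A nonnegative integral vanishes iff its integrand does almost everywhere. Together with
  its mirror image for \<open>L\<close>, this moves a null event from one disintegration to the
  other, which is how \<open>K\<close> and \<open>L\<close> are compared.\<close>

lemma null_disintegrates1_iff:
  fixes P :: "(real \<times> 'y::second_countable_topology) measure"
  assumes "disintegrates1 P K" "E \<in> sets borel"
  shows "emeasure P E = 0 \<longleftrightarrow> (AE x in marg1 P. emeasure (K x) {y. (x, y) \<in> E} = 0)"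
proof -
  have [measurable]: "K \<in> borel \<rightarrow>\<^sub>M subprob_algebra borel"
    using assms(1) by (auto simp: disintegrates1_def intro: measurable_prob_algebraD)
  have "E \<in> sets (borel \<Otimes>\<^sub>M borel)" by (subst borel_prod) (rule assms(2))
  moreover have "(SIGMA x:space borel. {y. (x, y) \<in> E}) = E" by auto
  ultimately have "(\<lambda>x. emeasure (K x) {y. (x, y) \<in> E}) \<in> borel_measurable borel"
    by (intro emeasure_measurable_subprob_algebra2[where N=borel]) auto
  then have "(\<lambda>x. emeasure (K x) {y. (x, y) \<in> E}) \<in> borel_measurable (marg1 P)"
    by (simp add: marg1_def)
  then show ?thesis
    using assms by (simp add: disintegrates1_def nn_integral_0_iff_AE)
qed

lemma null_disintegrates2_iff:
  fixes P :: "(real \<times> 'y::second_countable_topology) measure"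
  assumes "disintegrates2 P L" "E \<in> sets borel"
  shows "emeasure P E = 0 \<longleftrightarrow> (AE y in marg2 P. emeasure (L y) {x. (x, y) \<in> E} = 0)"
proof -
  have [measurable]: "L \<in> borel \<rightarrow>\<^sub>M subprob_algebra borel"
    using assms(1) by (auto simp: disintegrates2_def intro: measurable_prob_algebraD)
  have [measurable]: "E \<in> sets (borel \<Otimes>\<^sub>M borel)" by (subst borel_prod) (rule assms(2))
  \<comment> \<open>Sections along a kernel are taken with the kernel's variable first, so the
    coordinates of \<open>E\<close> are swapped.\<close>
  have "(SIGMA y:space borel. {x. (x, y) \<in> E}) = {p \<in> space (borel \<Otimes>\<^sub>M borel). (snd p, fst p) \<in> E}"
    by (auto simp: space_pair_measure)
  also have "\<dots> \<in> sets (borel \<Otimes>\<^sub>M borel)" by measurable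
  finally have "(\<lambda>y. emeasure (L y) {x. (x, y) \<in> E}) \<in> borel_measurable borel"
    by (intro emeasure_measurable_subprob_algebra2[where N=borel]) auto
  then have "(\<lambda>y. emeasure (L y) {x. (x, y) \<in> E}) \<in> borel_measurable (marg2 P)"
    by (simp add: marg2_def)
  then show ?thesis
    using assms by (simp add: disintegrates2_def nn_integral_0_iff_AE)
qed

section \<open>The atom map on the Dirac set\<close>

lemma return_atMost_eq_1_iff: "emeasure (return borel a) {..t} = 1 \<longleftrightarrow> a \<le> t"
  for a t :: real
  by (auto simp: indicator_def)

text \<open>A pointwise choice of atoms has no measurability of its own; it comes from the kernel,
  because on \<open>dirac_set L\<close> the condition \<open>a y \<le> t\<close> says that
  \<open>L y\<close> gives \<open>{..t}\<close> mass 1.\<close>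

lemma dirac_atom_measurable:
  fixes L :: "'y::topological_space \<Rightarrow> real measure"
  assumes L: "L \<in> borel \<rightarrow>\<^sub>M prob_algebra borel"
  obtains a where "a \<in> borel_measurable borel" "\<And>y. y \<in> dirac_set L \<Longrightarrow> L y = return borel (a y)"
proof -
  note [measurable] = dirac_set_borel[OF L]
  have [measurable]: "L \<in> borel \<rightarrow>\<^sub>M subprob_algebra borel"
    using L by (rule measurable_prob_algebraD)
  define b where "b y = (SOME a. L y = return borel a)" for y
  have b: "L y = return borel (b y)" if "y \<in> dirac_set L" for y
    using that unfolding b_def by (auto simp: dirac_set_def is_dirac_def intro: someI)
  define a where "a y = (if y \<in> dirac_set L then b y else 0)" for y
  have "{y \<in> space borel. a y \<le> t} \<in> sets borel" for t
  proof -
    have m [measurable]: "(\<lambda>y. emeasure (L y) {..t}) \<in> borel_measurable borel"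
      by (rule measurable_emeasure_kernel[of L borel borel]) auto
    have "a y \<le> t \<longleftrightarrow> (if y \<in> dirac_set L then emeasure (L y) {..t} = 1 else 0 \<le> t)" for y
      using b[of y] return_atMost_eq_1_iff[of "b y" t] by (simp add: a_def)
    then show ?thesis by simp
  qed
  then have "a \<in> borel_measurable borel"
    by (simp add: borel_measurable_iff_le)
  moreover have "L y = return borel (a y)" if "y \<in> dirac_set L" for y
    using b that by (simp add: a_def)
  ultimately show ?thesis by (rule that)
qed

lemma AE_atom_eq_on_dirac_set:
  fixes P :: "(real \<times> 'y::second_countable_topology) measure"
  assumes K: "disintegrates1 P K" and L: "disintegrates2 P L"
    and [measurable]: "a \<in> borel_measurable borel"
    and a: "\<And>y. y \<in> dirac_set L \<Longrightarrow> L y = return borel (a y)"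
  shows "AE x in marg1 P. AE y in K x. y \<in> dirac_set L \<longrightarrow> a y = x"
proof -
  have Lk: "L \<in> borel \<rightarrow>\<^sub>M prob_algebra borel" and Kk: "K \<in> borel \<rightarrow>\<^sub>M prob_algebra borel"
    using K L by (auto simp: disintegrates1_def disintegrates2_def)
  note [measurable] = dirac_set_borel[OF Lk]
  \<comment> \<open>The \<open>L\<close>-sections of this event are null for every \<open>y\<close>:
    empty off the Dirac set, and the complement of the atom on it.\<close>
  define E where "E = {p :: real \<times> 'y. snd p \<in> dirac_set L \<and> a (snd p) \<noteq> fst p}"
  have "E = {p \<in> space (borel \<Otimes>\<^sub>M borel). snd p \<in> dirac_set L \<and> a (snd p) \<noteq> fst p}"
    by (simp add: E_def space_pair_measure)
  also have "\<dots> \<in> sets (borel \<Otimes>\<^sub>M borel)" by measurable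
  finally have E: "E \<in> sets borel" by (subst (asm) borel_prod)
  have "emeasure (L y) {x. (x, y) \<in> E} = 0" for y
  proof (cases "y \<in> dirac_set L")
    case True
    have "{x. (x, y) \<in> E} = - {a y}" using True by (auto simp: E_def)
    then show ?thesis using a[OF True] by simp
  qed (simp add: E_def)
  then have "emeasure P E = 0"
    by (simp add: null_disintegrates2_iff[OF L E])
  then have "AE x in marg1 P. emeasure (K x) {y. (x, y) \<in> E} = 0"
    by (simp add: null_disintegrates1_iff[OF K E])
  then show ?thesis
  proof eventually_elim
    case (elim x)
    have [measurable_cong, simp]: "sets (K x) = sets borel" using prob_kernelD[OF Kk] by simp
    have "{y. (x, y) \<in> E} = {y \<in> space borel. y \<in> dirac_set L \<and> a y \<noteq> x}" by (simp add: E_def)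
    also have "\<dots> \<in> sets borel" by measurable
    finally have "{y. (x, y) \<in> E} \<in> null_sets (K x)" using elim by auto
    then have "AE y in K x. y \<notin> {y. (x, y) \<in> E}" by (rule AE_not_in)
    then show ?case by (auto simp: E_def)
  qed
qed

section \<open>Constructing a representing function\<close>

lemma cond_D_imp_prop_R_plus:
  fixes P :: "(real \<times> 'y::second_countable_topology) measure"
  assumes K: "disintegrates1 P K" and L: "disintegrates2 P L"
    and D: "cond_D (marg1 P) K L"
  shows "prop_R_plus (marg1 P) K"
  unfolding prop_R_plus_def
proof (intro allI impI, elim conjE)
  fix f :: "real \<Rightarrow> real"
  assume "integrable (marg1 P) f" and f0: "AE x in marg1 P. f x \<ge> 0"
  then have [measurable]: "f \<in> borel_measurable borel"
    by (auto simp: marg1_def dest: borel_measurable_integrable)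
  have Lk: "L \<in> borel \<rightarrow>\<^sub>M prob_algebra borel" and Kk: "K \<in> borel \<rightarrow>\<^sub>M prob_algebra borel"
    using K L by (auto simp: disintegrates1_def disintegrates2_def)
  note [measurable] = dirac_set_borel[OF Lk]
  have [measurable]: "K \<in> borel \<rightarrow>\<^sub>M subprob_algebra borel"
    using Kk by (rule measurable_prob_algebraD)
  obtain a where a [measurable]: "a \<in> borel_measurable borel"
    and La: "\<And>y. y \<in> dirac_set L \<Longrightarrow> L y = return borel (a y)"
    using dirac_atom_measurable[OF Lk] by blast
  have [measurable]: "(\<lambda>x. measure (K x) (dirac_set L)) \<in> borel_measurable borel"
    unfolding measure_def
    by (intro borel_measurable_enn2real measurable_emeasure_kernel[of K borel borel]) auto
  have ae: "AE x in marg1 P. AE y in K x. y \<in> dirac_set L \<longrightarrow> a y = x"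
    by (rule AE_atom_eq_on_dirac_set[OF K L a]) (rule La)
  \<comment> \<open>The \<open>max 0\<close> is there because \<open>f\<close> is nonnegative only
    almost everywhere, while \<open>g\<close> must be so everywhere. Where the denominator is 0,
    \<open>h\<close> takes the value 0; under \<open>cond_D\<close> this concerns a null set of
    \<open>x\<close>.\<close>
  define h where "h x = max 0 (f x) / measure (K x) (dirac_set L)" for x
  have [measurable]: "h \<in> borel_measurable borel" unfolding h_def by measurable
  define g where "g y = indicator (dirac_set L) y * h (a y)" for y
  have "g \<in> borel_measurable borel" unfolding g_def by measurable
  moreover have "\<forall>y. g y \<ge> 0" by (simp add: g_def h_def)
  moreover have "AE x in marg1 P. ennreal (f x) = (\<integral>\<^sup>+ y. ennreal (g y) \<partial>K x)"
    using f0 D[unfolded cond_D_def] ae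
  proof eventually_elim
    case (elim x)
    interpret prob_space "K x" using prob_kernelD[OF Kk] by simp
    have [measurable_cong, simp]: "sets (K x) = sets borel" using prob_kernelD[OF Kk] by simp
    have pos: "measure (K x) (dirac_set L) > 0" using elim(2) by (simp add: emeasure_eq_measure)
    have h0: "h x \<ge> 0" by (simp add: h_def)
    \<comment> \<open>Since \<open>a y = x\<close> for \<open>K x\<close>-almost every
      \<open>y\<close> in the Dirac set, \<open>h (a y)\<close> is there the constant
      \<open>h x\<close>.\<close>
    have "(\<integral>\<^sup>+ y. ennreal (g y) \<partial>K x) = (\<integral>\<^sup>+ y. ennreal (h x) * indicator (dirac_set L) y \<partial>K x)"
      by (rule nn_integral_cong_AE) (use elim(3) in \<open>auto simp: g_def indicator_def\<close>)
    also have "\<dots> = ennreal (h x) * emeasure (K x) (dirac_set L)"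
      by (rule nn_integral_cmult_indicator) simp
    also have "\<dots> = ennreal (f x)"
      using pos elim(1) h0 by (simp add: emeasure_eq_measure flip: ennreal_mult) (simp add: h_def)
    finally show ?case by simp
  qed
  ultimately show "\<exists>g. g \<in> borel_measurable borel \<and> (\<forall>y. g y \<ge> 0) \<and>
      (AE x in marg1 P. ennreal (f x) = (\<integral>\<^sup>+ y. ennreal (g y) \<partial>K x))"
    by blast
qed

section \<open>Necessity at the atoms of the first marginal\<close>

lemma prop_R_plus_imp_atom:
  fixes P :: "(real \<times> 'y::second_countable_topology) measure"
  assumes P: "prob_space P" "sets P = sets borel"
    and K: "disintegrates1 P K" and L: "disintegrates2 P L"
    and R: "prop_R_plus (marg1 P) K"
    and atom: "emeasure (marg1 P) {x0} \<noteq> 0"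
  shows "emeasure (K x0) (dirac_set L) > 0"
proof -
  have Lk: "L \<in> borel \<rightarrow>\<^sub>M prob_algebra borel" and Kk: "K \<in> borel \<rightarrow>\<^sub>M prob_algebra borel"
    using K L by (auto simp: disintegrates1_def disintegrates2_def)
  note [measurable] = dirac_set_borel[OF Lk]
  have [measurable_cong, simp]: "sets (K x) = sets borel" for x using prob_kernelD[OF Kk] by simp
  have [simp]: "sets (marg1 P) = sets borel" by (simp add: marg1_def)
  interpret \<mu>: prob_space "marg1 P" using P by (rule prob_space_marg1)
  \<comment> \<open>A point of positive mass cannot lie in an exceptional null set, so
    almost-everywhere statements may be evaluated at \<open>x0\<close>.\<close>
  have at_atom: "Q x0" if "AE x in marg1 P. Q x" for Q
  proof (rule ccontr)
    assume "\<not> Q x0"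
    from that have "AE x in marg1 P. x \<noteq> x0" by eventually_elim (use \<open>\<not> Q x0\<close> in auto)
    then have "{x0} \<in> null_sets (marg1 P)" by (simp add: AE_iff_null_sets)
    then show False using atom by (metis null_setsD1)
  qed
  have "integrable (marg1 P) (indicator {x0} :: real \<Rightarrow> real)"
    by (intro integrable_real_indicator) (simp_all add: \<mu>.emeasure_eq_measure)
  moreover have "AE x in marg1 P. (0 :: real) \<le> indicator {x0} x" by simp
  ultimately have "\<exists>g :: 'y \<Rightarrow> real. g \<in> borel_measurable borel \<and> (\<forall>y. g y \<ge> 0) \<and>
      (AE x in marg1 P. ennreal (indicator {x0} x) = (\<integral>\<^sup>+ y. ennreal (g y) \<partial>K x))"
    using R unfolding prop_R_plus_def by blast
  then obtain g :: "'y \<Rightarrow> real" where [measurable]: "g \<in> borel_measurable borel"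
    and g0: "\<And>y. g y \<ge> 0"
    and g: "AE x in marg1 P. ennreal (indicator {x0} x) = (\<integral>\<^sup>+ y. ennreal (g y) \<partial>K x)"
    by blast
  define G where "G = {y \<in> space borel. g y > 0}"
  have G [measurable]: "G \<in> sets borel" unfolding G_def by measurable
  \<comment> \<open>As \<open>g\<close> is nonnegative, only its support \<open>G\<close> decides
    whether the integral vanishes.\<close>
  have intg: "(\<integral>\<^sup>+ y. ennreal (g y) \<partial>K x) = 0 \<longleftrightarrow> emeasure (K x) G = 0" for x
  proof -
    have "space (K x) = UNIV" using sets_eq_imp_space_eq[of "K x" borel] by simp
    then show ?thesis
      using g0 by (subst nn_integral_0_iff) (auto simp: G_def zero_less_iff_neq_zero less_le)
  qed
  have KG: "emeasure (K x0) G \<noteq> 0"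
    using at_atom[OF g] by (simp flip: intg)
  \<comment> \<open>For \<open>x = x0\<close> the section is empty; for other \<open>x\<close> it is
    \<open>G\<close>, on which \<open>g\<close> integrates to the indicator's value 0.\<close>
  have "AE x in marg1 P. emeasure (K x) {y. (x, y) \<in> (- {x0}) \<times> G} = 0"
    using g
  proof eventually_elim
    case (elim x)
    then show ?case using intg[of x] by (cases "x = x0") auto
  qed
  moreover have E: "(- {x0}) \<times> G \<in> sets (borel :: (real \<times> 'y) measure)"
    by (simp flip: borel_prod)
  ultimately have "emeasure P ((- {x0}) \<times> G) = 0"
    by (simp add: null_disintegrates1_iff[OF K E])
  then have ae: "AE y in marg2 P. emeasure (L y) {x. (x, y) \<in> (- {x0}) \<times> G} = 0"
    by (simp add: null_disintegrates2_iff[OF L E])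
  have "AE y in marg2 P. emeasure (L y) {x. (x, y) \<in> UNIV \<times> (G - dirac_set L)} = 0"
    using ae
  proof eventually_elim
    case (elim y)
    have "y \<in> dirac_set L" if "y \<in> G"
    proof -
      interpret Ly: prob_space "L y" using prob_kernelD[OF Lk] by simp
      have s [measurable_cong, simp]: "sets (L y) = sets borel" using prob_kernelD[OF Lk] by simp
      have "{x. (x, y) \<in> (- {x0}) \<times> G} = - {x0}" using that by auto
      then have "- {x0} \<in> null_sets (L y)" using elim by (intro null_setsI) simp_all
      then have "AE x in L y. x \<notin> - {x0}" by (rule AE_not_in)
      then have x0: "AE x in L y. x = x0" by simp
      \<comment> \<open>Concentration at \<open>x0\<close> makes the distribution function of
        \<open>L y\<close> jump from 0 to 1, which is the criterion in
        \<open>is_dirac_iff\<close>.\<close>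
      have "emeasure (L y) {..q} = 0 \<or> emeasure (L y) {..q} = 1" for q
      proof (cases "x0 \<le> q")
        case True
        have "AE x in L y. x \<in> {..q}" using x0 True by auto
        then show ?thesis by (simp add: Ly.emeasure_eq_1_AE)
      next
        case False
        have "AE x in L y. x \<notin> {..q}" using x0 False by auto
        then show ?thesis by (subst (asm) AE_iff_null_sets[symmetric]) auto
      qed
      then show ?thesis using is_dirac_iff[OF Ly.prob_space_axioms s] by (auto simp: dirac_set_def)
    qed
    then show ?case by (cases "y \<in> G") auto
  qed
  moreover have F: "UNIV \<times> (G - dirac_set L) \<in> sets (borel :: (real \<times> 'y) measure)"
    by (simp flip: borel_prod)
  ultimately have "emeasure P (UNIV \<times> (G - dirac_set L)) = 0"
    by (simp add: null_disintegrates2_iff[OF L F])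
  \<comment> \<open>Back on the side of \<open>K\<close>, the null event is read at the atom:
    \<open>K x0\<close> charges \<open>G\<close> but not the part outside the Dirac set.\<close>
  then have "AE x in marg1 P. emeasure (K x) (G - dirac_set L) = 0"
    unfolding null_disintegrates1_iff[OF K F] by (simp add: set_diff_eq)
  then have null: "emeasure (K x0) (G - dirac_set L) = 0" by (rule at_atom)
  have "emeasure (K x0) G \<le> emeasure (K x0) ((G - dirac_set L) \<union> dirac_set L)"
    by (intro emeasure_mono) auto
  also have "\<dots> \<le> emeasure (K x0) (G - dirac_set L) + emeasure (K x0) (dirac_set L)"
    by (intro emeasure_subadditive) auto
  finally show ?thesis using KG null by (auto simp: zero_less_iff_neq_zero)
qed

section \<open>The discrete case and the conclusion\<close>

lemma discrete_measure_null_C_set: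
  assumes "sets \<mu> = sets borel" "C_set \<mu> K L \<in> sets borel" "discrete_measure \<mu>"
  shows "emeasure \<mu> (C_set \<mu> K L) = 0"
proof -
  obtain S where S: "countable S" "emeasure \<mu> (- S) = 0"
    using assms(3) by (auto simp: discrete_measure_def)
  \<comment> \<open>Countability makes \<open>S\<close> Borel, so the value 0 on \<open>- S\<close>
    is not the default for nonmeasurable sets.\<close>
  have "- S \<in> null_sets \<mu>"
    using S assms(1) by (intro null_setsI) (simp_all add: borel_comp sets.countable)
  \<comment> \<open>No point of \<open>C_set\<close> is an atom of \<open>\<mu>\<close>, so
    countably many of them have mass 0.\<close>
  moreover have "(\<Union>x \<in> S \<inter> C_set \<mu> K L. {x}) \<in> null_sets \<mu>"
    using S(1) assms(1) by (intro null_sets_UN') (auto simp: C_set_def)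
  ultimately have "- S \<union> (\<Union>x \<in> S \<inter> C_set \<mu> K L. {x}) \<in> null_sets \<mu>" by (rule null_sets.Un)
  then have "C_set \<mu> K L \<in> null_sets \<mu>"
    by (rule null_sets_subset) (use assms(1,2) in auto)
  then show ?thesis by auto
qed

theorem corollary2p5:
  fixes P :: "(real \<times> 'y::{banach, second_countable_topology}) measure"
    and \<mu> :: "real measure"
    and K :: "real \<Rightarrow> 'y measure"
    and L :: "'y \<Rightarrow> real measure"
  assumes "prob_space P" and "sets P = sets borel"
    and "\<mu> = marg1 P"
    and "disintegrates1 P K"
    and "disintegrates2 P L"
  shows "(emeasure \<mu> (C_set \<mu> K L) = 0 \<longrightarrow> (cond_D \<mu> K L \<longleftrightarrow> prop_R_plus \<mu> K)) \<and>
         (discrete_measure \<mu> \<longrightarrow> emeasure \<mu> (C_set \<mu> K L) = 0)"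
proof -
  have sets_\<mu>: "sets \<mu> = sets borel" using assms(3) by (simp add: marg1_def)
  have "prob_space \<mu>"
    unfolding assms(3) using assms(1,2) by (rule prob_space_marg1)
  then have C: "C_set \<mu> K L \<in> sets borel"
    using assms(4,5) sets_\<mu> by (intro C_set_borel) (auto simp: disintegrates1_def disintegrates2_def)
  have "cond_D \<mu> K L" if null: "emeasure \<mu> (C_set \<mu> K L) = 0" and R: "prop_R_plus \<mu> K"
  proof -
    have "C_set \<mu> K L \<in> null_sets \<mu>" using null C sets_\<mu> by auto
    then have "AE x in \<mu>. x \<notin> C_set \<mu> K L" by (rule AE_not_in)
    then show ?thesis
      unfolding cond_D_def
    proof eventually_elim
      case (elim x)
      show ?case
      \<comment> \<open>Outside \<open>C_set\<close> one summand is positive: either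
        \<open>K x\<close> charges the Dirac set already, or \<open>x\<close> is an atom.\<close>
      proof (cases "emeasure \<mu> {x} = 0")
        case True
        then show ?thesis using elim by (simp add: C_set_def zero_less_iff_neq_zero)
      next
        case False
        then show ?thesis using prop_R_plus_imp_atom[OF assms(1,2,4,5)] R assms(3) by simp
      qed
    qed
  qed
  then show ?thesis
    using cond_D_imp_prop_R_plus[OF assms(4,5)] discrete_measure_null_C_set[OF sets_\<mu> C] assms(3)
    by blast
qed

end
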